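(* The three oriented singular Reidemeister moves $\Omega4a$, $\Omega4e$ and $\Omega5a$ suffice to generate all oriented moves of types $\Omega4$ and $\Omega5$. That is, every oriented move of type $\Omega4$ and every oriented move of type $\Omega5$ on oriented singular link diagrams can be realized (up to planar isotopy) by a finite sequence of moves, each of which is $\Omega4a$, $\Omega4e$, $\Omega5a$, or a classical oriented Reidemeister move, or the inverse of one of these.
   Context: A singular link in $S^3$ is the image of a smooth immersion of finitely many circles having finitely many double points, called singular points; orienting each circle gives an oriented singular link. An oriented singular link diagram is a generic planar projection of an oriented singular link, with classical crossings (over/under information recorded) and singular crossings (projections of the singular points). Moves are local replacements inside a disk and are considered up to planar isotopy (in particular up to rotation). Classical oriented Reidemeister moves: the usual Reidemeister moves of types 1, 2, 3 ($\Omega1,\Omega2,\Omega3$) with any orientation of the strands; they do not involve singular crossings. Type $\Omega4$: a third strand that crosses two adjacent legs of a singular crossing, passing over both of them or under both of them, is moved across the singular crossing so that it crosses the other two legs instead (again over both, respectively under both). All orientations of the three strands are allowed; up to rotation this gives eight oriented moves, obtained as follows. Draw the singular crossing with both branches oriented downward. The third strand is either vertical (moved from the left of the singular crossing to the right; oriented up or down) or horizontal (moved from above the singular crossing to below; oriented left or right), and passes either over or under. Type $\Omega5$: two strands form a singular crossing followed vertically by a classical crossing (a singular crossing and a classical crossing joined by two edges that bound a bigon); the move replaces this by the classical crossing followed by the singular crossing, the classical crossing having the same strand order and type, i.e. the tangle $S\sigma$ is replaced by $\sigma S$ where $S$ denotes the singular crossing of two strands and $\sigma$ denotes one of the two possible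 unoriented classical crossings of two strands. All orientations of the two strands are allowed; up to rotation this gives six oriented moves. $\Omega4a$: the type $\Omega4$ move in which, with both branches of the singular crossing oriented downward, the third strand is vertical, oriented upward, and passes over; it is moved from the left of the singular crossing to its right. $\Omega4e$: the same move as $\Omega4a$ except that the third strand (vertical, oriented upward) passes under. $\Omega5a$: the type $\Omega5$ move with both strands oriented downward and with a positive classical crossing. *)

theory Defs
  imports Main
begin

text \<open>
  Diagrams are encoded in Morse position: after a planar isotopy a generic plane diagram is in
  general position with respect to the height function and decomposes, read from bottom to top,
  into horizontal slices, each containing exactly one elementary piece (a minimum, a maximum, or a
  crossing) and vertical strands to its left and right.  Since pieces carry arbitrary
  orientations, no normalisation of the direction of strands at crossings is needed.
\<close>

datatype orientation = Up | Down

fun opp :: "orientation \<Rightarrow> orientation" where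
  "opp Up = Down"
| "opp Down = Up"

text \<open>
  Crossings are drawn as the letter X.  In \<open>Classical w\<close> the strand going from bottom left to
  top right (the strand that is on the left below the crossing) is the over-strand iff \<open>w\<close>.
\<close>

datatype crossing = Classical bool | Singular

text \<open>A quarter turn, or a reflection in the vertical axis, exchanges the two diagonals.\<close>

fun turn :: "crossing \<Rightarrow> crossing" where
  "turn (Classical w) = Classical (\<not> w)"
| "turn Singular = Singular"

text \<open>
  \<open>Cup a\<close> is a minimum and \<open>Cap a\<close> a maximum whose left leg has orientation \<open>a\<close>.
  In \<open>Cross x a b\<close> the strand with orientation \<open>a\<close> runs between bottom left and top right, the one
  with orientation \<open>b\<close> between bottom right and top left.
\<close>

datatype piece = Cup orientation | Cap orientation | Cross crossing orientation orientation

fun src :: "piece \<Rightarrow> orientation list" where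
  "src (Cup a) = []"
| "src (Cap a) = [a, opp a]"
| "src (Cross x a b) = [a, b]"

fun tgt :: "piece \<Rightarrow> orientation list" where
  "tgt (Cup a) = [a, opp a]"
| "tgt (Cap a) = []"
| "tgt (Cross x a b) = [b, a]"

text \<open>A slice lists the vertical strands left of its piece, the piece, and those right of it.\<close>

type_synonym slice = "orientation list \<times> piece \<times> orientation list"
type_synonym diagram = "slice list"

text \<open>\<open>tangle u D v\<close>: the slices of \<open>D\<close> fit together, with lower boundary \<open>u\<close> and upper boundary \<open>v\<close>.\<close>

fun tangle :: "orientation list \<Rightarrow> diagram \<Rightarrow> orientation list \<Rightarrow> bool" where
  "tangle u [] v \<longleftrightarrow> u = v"
| "tangle u ((l, g, r) # D) v \<longleftrightarrow> u = l @ src g @ r \<and> tangle (l @ tgt g @ r) D v"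

definition singular_link_diagram :: "diagram \<Rightarrow> bool" where
  "singular_link_diagram D \<longleftrightarrow> tangle [] D []"

definition place :: "orientation list \<Rightarrow> orientation list \<Rightarrow> diagram \<Rightarrow> diagram" where
  "place l r T = map (\<lambda>(l', g, r'). (l @ l', g, r' @ r)) T"

text \<open>
  A family of moves is a set of pairs (before, after) of tangles in a rectangular disk with equal
  boundaries.  A local replacement exchanges one for the other in a link diagram; the strands
  \<open>l\<close> and \<open>r\<close> pass the disk on its left and right, and \<open>A\<close> and \<open>B\<close> are the parts of the diagram
  below and above it.
\<close>

type_synonym moves = "(diagram \<times> diagram) set"

definition local_replacement :: "moves \<Rightarrow> diagram \<Rightarrow> diagram \<Rightarrow> bool" where
  "local_replacement M D D' \<longleftrightarrow>
     singular_link_diagram D \<and> singular_link_diagram D' \<and>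
     (\<exists>T T' A B l r. (T, T') \<in> M \<and>
        D = A @ place l r T @ B \<and> D' = A @ place l r T' @ B)"

subsection \<open>Planar isotopy\<close>

text \<open>
  The codimension-one events of a generic planar isotopy with respect to the height function: two
  pieces exchange their heights; a maximum and a minimum cancel (or are born); a branch at a
  crossing becomes horizontal, so that a maximum or minimum of that branch passes through the
  crossing, from one side of the other branch to the other.
\<close>

definition exchange :: moves where
  "exchange =
     {([([], g, m @ src h), (tgt g @ m, h, [])],
       [(src g @ m, h, []), ([], g, m @ tgt h)]) | g h m. True}"

definition zigzag :: moves where
  "zigzag =
     {([([a], Cup (opp a), []), ([], Cap a, [a])], []) | a. True} \<union>
     {([([], Cup a, [a]), ([a], Cap (opp a), [])], []) | a. True}"

definition cap_through_crossing :: moves where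
  "cap_through_crossing =
     {([([], Cross x a b, [opp a]), ([b], Cap a, [])],
       [([a], Cross (turn x) b (opp a), []), ([], Cap a, [b])]) | x a b. True}"

definition cup_through_crossing :: moves where
  "cup_through_crossing =
     {([([b], Cup a, []), ([], Cross x b a, [opp a])],
       [([], Cup a, [b]), ([a], Cross (turn x) (opp a) b, [])]) | x a b. True}"

definition isotopy_events :: moves where
  "isotopy_events = exchange \<union> zigzag \<union> cap_through_crossing \<union> cup_through_crossing"

definition planar_isotopic :: "diagram \<Rightarrow> diagram \<Rightarrow> bool" where
  "planar_isotopic =
     (\<lambda>D D'. local_replacement isotopy_events D D' \<or> local_replacement isotopy_events D' D)\<^sup>*\<^sup>*"

definition oriented_move :: "moves \<Rightarrow> diagram \<Rightarrow> diagram \<Rightarrow> bool" where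
  "oriented_move M D D' \<longleftrightarrow>
     (\<exists>E E'. planar_isotopic D E \<and> local_replacement M E E' \<and> planar_isotopic E' D')"

definition realizable :: "moves \<Rightarrow> diagram \<Rightarrow> diagram \<Rightarrow> bool" where
  "realizable M =
     (\<lambda>D D'. planar_isotopic D D' \<or> oriented_move M D D' \<or> oriented_move M D' D)\<^sup>*\<^sup>*"

subsection \<open>Classical moves\<close>

text \<open>Kinks on the right and on the left of the strand.\<close>

definition Omega1 :: moves where
  "Omega1 =
     {([([a], Cup a, []), ([], Cross (Classical w) a a, [opp a]), ([a], Cap a, [])], [])
       | a w. True} \<union>
     {([([], Cup (opp a), [a]), ([opp a], Cross (Classical w) a a, []), ([], Cap (opp a), [a])], [])
       | a w. True}"

definition Omega2 :: moves where
  "Omega2 =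
     {([([], Cross (Classical w) a b, []), ([], Cross (Classical (\<not> w)) b a, [])], [])
       | a b w. True}"

text \<open>
  The strands \<open>a\<close>, \<open>b\<close>, \<open>c\<close>, which start at the bottom from left to right, lie at pairwise
  distinct heights \<open>p\<close>, \<open>q\<close>, \<open>s\<close> above the plane of projection.
\<close>

definition Omega3 :: moves where
  "Omega3 =
     {([([], Cross (Classical (p > q)) a b, [c]), ([b], Cross (Classical (p > s)) a c, []),
        ([], Cross (Classical (q > s)) b c, [a])],
       [([a], Cross (Classical (q > s)) b c, []), ([], Cross (Classical (p > s)) a c, [b]),
        ([c], Cross (Classical (p > q)) a b, [])])
       | a b c p q s. distinct [p, q, s :: nat]}"

subsection \<open>Moves with singular crossings\<close>

text \<open>
  In both type 4 moves \<open>a\<close> and \<open>b\<close> are the branches of the singular crossing and \<open>c\<close> is the third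
  strand, which passes over both branches iff \<open>w\<close>.

  The vertical strand starts and ends between the two branches and is moved from the left to
  the right of the singular crossing.  The horizontal strand runs between the left end (drawn at
  the bottom left) and the right end (drawn at the top right) of the disk, is oriented to the
  right iff \<open>c = Up\<close>, and is moved from above to below the singular crossing.
\<close>

definition Omega4_vertical ::
  "bool \<Rightarrow> orientation \<Rightarrow> orientation \<Rightarrow> orientation \<Rightarrow> diagram \<times> diagram" where
  "Omega4_vertical w a b c =
     ([([], Cross (Classical (\<not> w)) a c, [b]), ([c], Cross Singular a b, []),
       ([], Cross (Classical w) c b, [a])],
      [([a], Cross (Classical w) c b, []), ([], Cross Singular a b, [c]),
       ([b], Cross (Classical (\<not> w)) a c, [])])"

definition Omega4_horizontal ::
  "bool \<Rightarrow> orientation \<Rightarrow> orientation \<Rightarrow> orientation \<Rightarrow> diagram \<times> diagram" where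
  "Omega4_horizontal w a b c =
     ([([c], Cross Singular a b, []), ([], Cross (Classical w) c b, [a]),
       ([b], Cross (Classical w) c a, [])],
      [([], Cross (Classical w) c a, [b]), ([a], Cross (Classical w) c b, []),
       ([], Cross Singular a b, [c])])"

text \<open>
  All orientations are included, so every move occurs in several positions that agree up to
  rotation.  Up to rotation and inversion the eight moves with \<open>a = b = Down\<close> represent all.
\<close>

definition Omega4 :: moves where
  "Omega4 =
     {Omega4_vertical w a b c | w a b c. True} \<union> {Omega4_horizontal w a b c | w a b c. True}"

definition Omega4a :: moves where
  "Omega4a = {Omega4_vertical True Down Down Up}"

definition Omega4e :: moves where
  "Omega4e = {Omega4_vertical False Down Down Up}"

definition Omega5_move :: "bool \<Rightarrow> orientation \<Rightarrow> orientation \<Rightarrow> diagram \<times> diagram" where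
  "Omega5_move w a b =
     ([([], Cross Singular a b, []), ([], Cross (Classical w) b a, [])],
      [([], Cross (Classical w) a b, []), ([], Cross Singular b a, [])])"

definition Omega5 :: moves where
  "Omega5 = {Omega5_move w a b | w a b. True}"

text \<open>
  The sign of \<open>Cross (Classical w) a b\<close>.  If both strands point up, it is positive iff the
  over-strand runs from bottom left to top right; reversing one strand changes the sign.
\<close>

definition positive :: "bool \<Rightarrow> orientation \<Rightarrow> orientation \<Rightarrow> bool" where
  "positive w a b \<longleftrightarrow> (w \<longleftrightarrow> a = b)"

definition Omega5a :: moves where
  "Omega5a = {Omega5_move w Down Down | w. positive w Down Down}"

subsection \<open>Consistency of the encoding\<close>

lemma opp_opp [simp]: "opp (opp a) = a"
  by (cases a) auto

lemma moves_preserve_boundary: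
  assumes "(T, T') \<in> isotopy_events \<union> Omega1 \<union> Omega2 \<union> Omega3 \<union> Omega4 \<union> Omega5"
  shows "\<exists>u v. tangle u T v \<and> tangle u T' v"
  using assms
  unfolding isotopy_events_def exchange_def zigzag_def cap_through_crossing_def
    cup_through_crossing_def Omega1_def Omega2_def Omega3_def Omega4_def Omega4_vertical_def
    Omega4_horizontal_def Omega5_def Omega5_move_def
  by auto

end

theory Submission
  imports Defs
begin

text \<open>
  Type 4 moves are identities between three-strand braid words.  Conjugating such an identity by a
  classical crossing and cancelling with type 2 moves exchanges the vertical and the horizontal
  form of the move, and bending one strand on each side turns the disk by a sixth of a turn.
  Together these operations reach all orientations from \<open>\<Omega>4a\<close> (third strand over) and
  \<open>\<Omega>4e\<close> (third strand under).

  A type 5 move says that a half twist can be moved from one side of a singular crossing to the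
  other.  Pulling a leg over or under the whole crossing turns the crossing by a quarter turn;
  pulling one leg over and another one under it expresses the move for antiparallel branches by
  the move for parallel branches.
\<close>

section \<open>Stacking and juxtaposing tangles\<close>

lemma tangle_append: "tangle u (D @ E) v \<longleftrightarrow> (\<exists>w. tangle u D w \<and> tangle w E v)"
  by (induction D arbitrary: u) auto

lemma place_Nil [simp]: "place l r [] = []"
  and place_Cons [simp]: "place l r ((l', g, r') # T) = (l @ l', g, r' @ r) # place l r T"
  and place_append [simp]: "place l r (T @ T') = place l r T @ place l r T'"
  and length_place [simp]: "length (place l r T) = length T"
  by (auto simp: place_def)

lemma place_place [simp]: "place l r (place l' r' T) = place (l @ l') (r' @ r) T"
  by (auto simp: place_def)

lemma place_Nil_Nil [simp]: "place [] [] T = T"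
  by (auto simp: place_def map_idI)

lemma tangle_place: "tangle u T v \<Longrightarrow> tangle (l @ u @ r) (place l r T) (l @ v @ r)"
  by (induction T arbitrary: u) (auto, metis append_assoc)

lemma tangle_place_Nil: "tangle u T v \<Longrightarrow> tangle (u @ r) (place [] r T) (v @ r)"
  using tangle_place[of u T v "[]" r] by simp

text \<open>The first slice fixes the lower boundary, and the slices then determine the upper one;
  the empty diagram fits every boundary and is excluded. This identifies the boundary of a disk cut
  out of a link diagram with that of the move performed in it.\<close>

lemma tangle_boundary_unique:
  assumes "tangle u T v" "tangle u' T v'" "T \<noteq> []"
  shows "u = u' \<and> v = v'"
proof -
  have functional: "v = v'" if "tangle u T v" "tangle u T v'" for u T
    using that by (induction T arbitrary: u) auto
  have "u = u'"
    using assms by (cases T) auto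
  with functional assms show ?thesis by blast
qed

lemma turn_turn [simp]: "turn (turn x) = x"
  by (cases x) auto

subsection \<open>Equivalence of tangles\<close>

text \<open>
  The boundaries are part of the relation because the empty diagram is a tangle with any boundary;
  otherwise two straight strands of different orientations would become equivalent.
\<close>

definition tangle_step ::
  "moves \<Rightarrow> orientation list \<Rightarrow> orientation list \<Rightarrow> diagram \<Rightarrow> diagram \<Rightarrow> bool" where
  "tangle_step M u v D D' \<longleftrightarrow> tangle u D v \<and> tangle u D' v \<and>
     (\<exists>T T' A B l r. (T, T') \<in> M \<and> D = A @ place l r T @ B \<and> D' = A @ place l r T' @ B)"

definition tangle_equiv ::
  "moves \<Rightarrow> orientation list \<Rightarrow> orientation list \<Rightarrow> diagram \<Rightarrow> diagram \<Rightarrow> bool" where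
  "tangle_equiv M u v =
     (\<lambda>D D'. tangle_step (isotopy_events \<union> M) u v D D' \<or>
       tangle_step (isotopy_events \<union> M) u v D' D)\<^sup>*\<^sup>*"

lemma tangle_equiv_refl [simp]: "tangle_equiv M u v D D"
  by (simp add: tangle_equiv_def)

lemma tangle_equiv_trans [trans]:
  "tangle_equiv M u v D E \<Longrightarrow> tangle_equiv M u v E F \<Longrightarrow> tangle_equiv M u v D F"
  unfolding tangle_equiv_def by (rule rtranclp_trans)

lemma tangle_equiv_sym: "tangle_equiv M u v D E \<Longrightarrow> tangle_equiv M u v E D"
  unfolding tangle_equiv_def by (rule sympD[OF symp_rtranclp]) (auto intro: sympI)

lemma tangle_equiv_move:
  assumes "(T, T') \<in> isotopy_events \<union> M" "tangle u T v" "tangle u T' v"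
  shows "tangle_equiv M u v T T'"
proof -
  have "tangle_step (isotopy_events \<union> M) u v T T'"
    unfolding tangle_step_def using assms
    by (intro conjI exI[of _ T] exI[of _ T'] exI[of _ "[]"]) auto
  then show ?thesis
    by (auto simp: tangle_equiv_def)
qed

lemma tangle_step_context:
  assumes "tangle_step M u v D D'" "tangle u0 A (l @ u @ r)" "tangle (l @ v @ r) B v0"
  shows "tangle_step M u0 v0 (A @ place l r D @ B) (A @ place l r D' @ B)"
proof -
  from assms(1) obtain T T' A' B' l' r' where T: "(T, T') \<in> M"
    "D = A' @ place l' r' T @ B'" "D' = A' @ place l' r' T' @ B'"
    and *: "tangle u D v" "tangle u D' v"
    unfolding tangle_step_def by auto
  have "A @ place l r D @ B = (A @ place l r A') @ place (l @ l') (r' @ r) T @ (place l r B' @ B)"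
    "A @ place l r D' @ B = (A @ place l r A') @ place (l @ l') (r' @ r) T' @ (place l r B' @ B)"
    using T by auto
  moreover have "tangle u0 (A @ place l r D @ B) v0" "tangle u0 (A @ place l r D' @ B) v0"
    using assms(2,3) *[THEN tangle_place, of l r] by (auto simp: tangle_append)
  ultimately show ?thesis
    unfolding tangle_step_def using T(1) by blast
qed

text \<open>Congruence: a disk inside a disk is again a disk of the outer diagram, so each step
  survives adding strands on both sides and slices below and above.\<close>

lemma tangle_equiv_context:
  assumes "tangle_equiv M u v D D'" "tangle u0 A (l @ u @ r)" "tangle (l @ v @ r) B v0"
  shows "tangle_equiv M u0 v0 (A @ place l r D @ B) (A @ place l r D' @ B)"
  using assms(1) unfolding tangle_equiv_def
proof (induction rule: rtranclp_induct)
  case (step E F)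
  then show ?case
    using tangle_step_context[OF _ assms(2,3), of "isotopy_events \<union> M"]
    by (elim disjE) (rule rtranclp.rtrancl_into_rtrancl, assumption, blast)+
qed simp

text \<open>Rewriting at slice \<open>n\<close> with strands \<open>l\<close> and \<open>r\<close>
  beside the disk. The surroundings are computed by \<open>take\<close> and \<open>drop\<close>, so
  that for explicit diagrams all side conditions reduce to evaluation.\<close>

lemma tangle_equiv_at:
  assumes "tangle_equiv M u v T T'"
    and "tangle u0 (take n D) (l @ u @ r)"
    and "place l r T = take (length T) (drop n D)"
    and "tangle (l @ v @ r) (drop (n + length T) D) v0"
    and "D' = take n D @ place l r T' @ drop (n + length T) D"
  shows "tangle_equiv M u0 v0 D D'"
proof -
  have "D = take n D @ place l r T @ drop (n + length T) D"
    using assms(3) by (metis add.commute append_take_drop_id drop_drop)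
  then show ?thesis
    using tangle_equiv_context[OF assms(1,2,4)] assms(5) by simp
qed

text \<open>With empty boundary a step is a local replacement in a link diagram, either an isotopy
  event or a move surrounded by trivial isotopies; \<open>realizable\<close> admits both
  directions.\<close>

lemma realizable_if_tangle_equiv:
  assumes "tangle_equiv M [] [] D D'"
  shows "realizable M D D'"
proof -
  have st: "realizable M E F \<and> realizable M F E"
    if that: "tangle_step (isotopy_events \<union> M) [] [] E F" for E F
  proof -
    have "local_replacement isotopy_events E F \<or> local_replacement M E F"
      using that unfolding tangle_step_def local_replacement_def singular_link_diagram_def by blast
    then show ?thesis
    proof
      assume "local_replacement isotopy_events E F"
      then have "planar_isotopic E F" "planar_isotopic F E"
        unfolding planar_isotopic_def by auto
      then show ?thesis
        unfolding realizable_def by auto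
    next
      assume "local_replacement M E F"
      then have "oriented_move M E F"
        unfolding oriented_move_def planar_isotopic_def by blast
      then show ?thesis
        unfolding realizable_def by auto
    qed
  qed
  show ?thesis
    using assms unfolding tangle_equiv_def
  proof (induction rule: rtranclp_induct)
    case base
    then show ?case by (simp add: realizable_def)
  next
    case (step E F)
    then have "realizable M E F"
      using st by blast
    with step.IH show ?case
      unfolding realizable_def by (rule rtranclp_trans)
  qed
qed

subsection \<open>Planar isotopy of tangles\<close>

lemma equiv_exchange:
  "tangle_equiv M (src g @ m @ src h) (tgt g @ m @ tgt h)
     [([], g, m @ src h), (tgt g @ m, h, [])] [(src g @ m, h, []), ([], g, m @ tgt h)]"
  by (rule tangle_equiv_move) (auto simp: isotopy_events_def exchange_def)

lemma equiv_zigzag_left: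
  "tangle_equiv M [a] [a] [([a], Cup (opp a), []), ([], Cap a, [a])] []"
  by (rule tangle_equiv_move) (auto simp: isotopy_events_def zigzag_def)

lemma equiv_zigzag_right:
  "tangle_equiv M [a] [a] [([], Cup a, [a]), ([a], Cap (opp a), [])] []"
  by (rule tangle_equiv_move) (auto simp: isotopy_events_def zigzag_def)

lemma equiv_cap_through_crossing:
  "tangle_equiv M [a, b, opp a] [b]
     [([], Cross x a b, [opp a]), ([b], Cap a, [])]
     [([a], Cross (turn x) b (opp a), []), ([], Cap a, [b])]"
  by (rule tangle_equiv_move) (auto simp: isotopy_events_def cap_through_crossing_def)

lemma equiv_cup_through_crossing:
  "tangle_equiv M [b] [a, b, opp a]
     [([b], Cup a, []), ([], Cross x b a, [opp a])]
     [([], Cup a, [b]), ([a], Cross (turn x) (opp a) b, [])]"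
  by (rule tangle_equiv_move) (auto simp: isotopy_events_def cup_through_crossing_def)

text \<open>The piece \<open>h\<close> to the right of \<open>T\<close> sinks past one slice of
  \<open>T\<close> at a time.\<close>

lemma equiv_exchange_tangle:
  "tangle u T v \<Longrightarrow>
   tangle_equiv M (u @ src h) (v @ tgt h)
     (place [] (src h) T @ [(v, h, [])]) ((u, h, []) # place [] (tgt h) T)"
proof (induction T arbitrary: u)
  case Nil
  then show ?case by simp
next
  case (Cons s T)
  obtain l g r where s: "s = (l, g, r)" by (cases s)
  have u: "u = l @ src g @ r" and T: "tangle (l @ tgt g @ r) T v"
    using Cons.prems s by auto
  have "tangle_equiv M (u @ src h) (v @ tgt h)
     ((l, g, r @ src h) # (place [] (src h) T @ [(v, h, [])]))
     ((l, g, r @ src h) # (l @ tgt g @ r, h, []) # place [] (tgt h) T)"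
    using tangle_equiv_context[OF Cons.IH[OF T], where A = "[(l, g, r @ src h)]" and B = "[]"
        and l = "[]" and r = "[]"]
    by (simp add: u)
  also have "tangle_equiv M (u @ src h) (v @ tgt h) \<dots>
     ((l @ src g @ r, h, []) # (l, g, r @ tgt h) # place [] (tgt h) T)"
    using tangle_equiv_context[OF equiv_exchange[of M g r h], where A = "[]" and l = l and r = "[]"
        and B = "place [] (tgt h) T"] tangle_place_Nil[OF T, of "tgt h"]
    by (simp add: u)
  finally show ?case
    by (simp add: s u)
qed

text \<open>Bending the last upper end down to the right is reversible: a further cup bends it back
  up, and the resulting zigzag straightens. Hence no information is lost by bending.\<close>

lemma unbend_right:
  assumes X: "tangle u X (v @ [q])" and Y: "tangle u Y (v @ [q])"
    and eq: "tangle_equiv M (u @ [opp q]) v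
      (place [] [opp q] X @ [(v, Cap q, [])]) (place [] [opp q] Y @ [(v, Cap q, [])])"
  shows "tangle_equiv M u (v @ [q]) X Y"
proof -
  \<comment> \<open>A zigzag is born on the last upper end of \<open>Z\<close>, and its minimum then
    sinks below \<open>Z\<close>.\<close>
  have bend: "tangle_equiv M u (v @ [q]) Z
      ((u, Cup (opp q), []) # place [] [q] (place [] [opp q] Z @ [(v, Cap q, [])]))"
    if Z: "tangle u Z (v @ [q])" for Z
  proof -
    have "tangle_equiv M u (v @ [q]) Z (Z @ [(v @ [q], Cup (opp q), []), (v, Cap q, [q])])"
      using tangle_equiv_context[OF tangle_equiv_sym[OF equiv_zigzag_left[of M q]],
          where A = Z and l = v and r = "[]" and B = "[]"] Z by simp
    also have "tangle_equiv M u (v @ [q]) \<dots>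
        ((u, Cup (opp q), []) # place [] [opp q, q] Z @ [(v, Cap q, [q])])"
      using tangle_equiv_context[OF equiv_exchange_tangle[OF Z, of M "Cup (opp q)"],
          where A = "[]" and l = "[]" and r = "[]" and B = "[(v, Cap q, [q])]"] by simp
    finally show ?thesis by simp
  qed
  have "tangle_equiv M u (v @ [q])
      ((u, Cup (opp q), []) # place [] [q] (place [] [opp q] X @ [(v, Cap q, [])]))
      ((u, Cup (opp q), []) # place [] [q] (place [] [opp q] Y @ [(v, Cap q, [])]))"
    using tangle_equiv_context[OF eq, where A = "[(u, Cup (opp q), [])]" and B = "[]"
        and l = "[]" and r = "[q]" and ?v0.0 = "v @ [q]" and ?u0.0 = u] by simp
  then show ?thesis
    using bend[OF X] bend[OF Y] by (meson tangle_equiv_sym tangle_equiv_trans)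
qed

section \<open>Three-strand words and their rotation by a sixth of a turn\<close>

text \<open>The digits give the positions of the crossings from bottom to top: 1 for the left pair
  of strands, 2 for the right pair. In both words each pair of strands crosses exactly once.\<close>

definition braid121 where
  "braid121 x y z a b c =
     [([], Cross x a b, [c]), ([b], Cross y a c, []), ([], Cross z b c, [a])]"

definition braid212 where
  "braid212 x y z a b c =
     [([a], Cross x b c, []), ([], Cross y a c, [b]), ([c], Cross z a b, [])]"

text \<open>The lower end of strand \<open>a\<close> is bent up on the left and its upper end down
  on the right. The minimum travels to the right through the two crossings on this strand, which are
  thereby turned; the crossing of \<open>b\<close> and \<open>c\<close> keeps its type.\<close>

lemma rotate_braid121:
  "tangle_equiv M [b, c, opp a] [opp a, c, b]
     (([], Cup (opp a), [b, c, opp a]) # place [opp a] [opp a] (braid121 x y z a b c)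
        @ [([opp a, c, b], Cap a, [])])
     (braid212 (turn y) (turn x) z b c (opp a))"
proof -
  let ?R = "tangle_equiv M [b, c, opp a] [opp a, c, b]"
  have "?R (([], Cup (opp a), [b, c, opp a]) # place [opp a] [opp a] (braid121 x y z a b c)
        @ [([opp a, c, b], Cap a, [])])
     [([b], Cup (opp a), [c, opp a]),
      ([], Cross (turn x) b (opp a), [a, c, opp a]),
      ([opp a, b], Cross y a c, [opp a]),
      ([opp a], Cross z b c, [a, opp a]),
      ([opp a, c, b], Cap a, [])]"
    by (rule tangle_equiv_at[OF tangle_equiv_sym[OF
            equiv_cup_through_crossing[of M b "opp a" "turn x"]],
          where n = 0 and l = "[]" and r = "[c, opp a]"])
      (simp_all add: braid121_def braid212_def)
  also have "?R \<dots>
     [([b], Cup (opp a), [c, opp a]),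
      ([b, opp a], Cross y a c, [opp a]),
      ([], Cross (turn x) b (opp a), [c, a, opp a]),
      ([opp a], Cross z b c, [a, opp a]),
      ([opp a, c, b], Cap a, [])]"
    by (rule tangle_equiv_at[OF equiv_exchange[of M "Cross (turn x) b (opp a)" "[]" "Cross y a c"],
          where n = 1 and l = "[]" and r = "[opp a]"])
      (simp_all add: braid121_def braid212_def)
  also have "?R \<dots>
     [([b, c], Cup (opp a), [opp a]),
      ([b], Cross (turn y) c (opp a), [a, opp a]),
      ([], Cross (turn x) b (opp a), [c, a, opp a]),
      ([opp a], Cross z b c, [a, opp a]),
      ([opp a, c, b], Cap a, [])]"
    by (rule tangle_equiv_at[OF tangle_equiv_sym[OF
            equiv_cup_through_crossing[of M c "opp a" "turn y"]],
          where n = 0 and l = "[b]" and r = "[opp a]"])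
      (simp_all add: braid121_def braid212_def)
  \<comment> \<open>The closing cap sinks past the whole word until it meets the cup and forms a
    zigzag with it.\<close>
  also have "?R \<dots>
     (([b, c], Cup (opp a), [opp a]) # ([b, c, opp a], Cap a, []) #
      braid212 (turn y) (turn x) z b c (opp a))"
    by (rule tangle_equiv_at[OF equiv_exchange_tangle[of "[b, c, opp a]" "braid212 (turn y) (turn x) z b c (opp a)" "[opp a, c, b]" M "Cap a"],
          where n = 1 and l = "[]" and r = "[]"])
      (simp_all add: braid121_def braid212_def)
  also have "?R \<dots>
     (braid212 (turn y) (turn x) z b c (opp a))"
    by (rule tangle_equiv_at[OF equiv_zigzag_right[of M "opp a"],
          where n = 0 and l = "[b, c]" and r = "[]"])
      (simp_all add: braid121_def braid212_def)
  finally show ?thesis .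
qed

lemma rotate_braid212:
  "tangle_equiv M [b, c, opp a] [opp a, c, b]
     (([], Cup (opp a), [b, c, opp a]) # place [opp a] [opp a] (braid212 x y z a b c)
        @ [([opp a, c, b], Cap a, [])])
     (braid121 x (turn z) (turn y) b c (opp a))"
proof -
  let ?R = "tangle_equiv M [b, c, opp a] [opp a, c, b]"
  have "?R (([], Cup (opp a), [b, c, opp a]) # place [opp a] [opp a] (braid212 x y z a b c)
        @ [([opp a, c, b], Cap a, [])])
     [([], Cross x b c, [opp a]),
      ([], Cup (opp a), [c, b, opp a]),
      ([opp a], Cross y a c, [b, opp a]),
      ([opp a, c], Cross z a b, [opp a]),
      ([opp a, c, b], Cap a, [])]"
    by (rule tangle_equiv_at[OF equiv_exchange[of M "Cup (opp a)" "[]" "Cross x b c"],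
          where n = 0 and l = "[]" and r = "[opp a]"])
      (simp_all add: braid121_def braid212_def)
  also have "?R \<dots>
     [([], Cross x b c, [opp a]),
      ([c], Cup (opp a), [b, opp a]),
      ([], Cross (turn y) c (opp a), [a, b, opp a]),
      ([opp a, c], Cross z a b, [opp a]),
      ([opp a, c, b], Cap a, [])]"
    by (rule tangle_equiv_at[OF tangle_equiv_sym[OF
            equiv_cup_through_crossing[of M c "opp a" "turn y"]],
          where n = 1 and l = "[]" and r = "[b, opp a]"])
      (simp_all add: braid121_def braid212_def)
  also have "?R \<dots>
     [([], Cross x b c, [opp a]),
      ([c], Cup (opp a), [b, opp a]),
      ([c, opp a], Cross z a b, [opp a]),
      ([], Cross (turn y) c (opp a), [b, a, opp a]),
      ([opp a, c, b], Cap a, [])]"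
    by (rule tangle_equiv_at[OF equiv_exchange[of M "Cross (turn y) c (opp a)" "[]" "Cross z a b"],
          where n = 2 and l = "[]" and r = "[opp a]"])
      (simp_all add: braid121_def braid212_def)
  also have "?R \<dots>
     [([], Cross x b c, [opp a]),
      ([c, b], Cup (opp a), [opp a]),
      ([c], Cross (turn z) b (opp a), [a, opp a]),
      ([], Cross (turn y) c (opp a), [b, a, opp a]),
      ([opp a, c, b], Cap a, [])]"
    by (rule tangle_equiv_at[OF tangle_equiv_sym[OF
            equiv_cup_through_crossing[of M b "opp a" "turn z"]],
          where n = 1 and l = "[c]" and r = "[opp a]"])
      (simp_all add: braid121_def braid212_def)
  also have "?R \<dots>
     [([], Cross x b c, [opp a]),
      ([c, b], Cup (opp a), [opp a]),
      ([c, b, opp a], Cap a, []),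
      ([c], Cross (turn z) b (opp a), []),
      ([], Cross (turn y) c (opp a), [b])]"
    by (rule tangle_equiv_at[OF equiv_exchange_tangle[of "[c, b, opp a]" "[([c], Cross (turn z) b (opp a), []),
      ([], Cross (turn y) c (opp a), [b])]" "[opp a, c, b]" M "Cap a"],
          where n = 2 and l = "[]" and r = "[]"])
      (simp_all add: braid121_def braid212_def)
  also have "?R \<dots>
     (braid121 x (turn z) (turn y) b c (opp a))"
    by (rule tangle_equiv_at[OF equiv_zigzag_right[of M "opp a"],
          where n = 1 and l = "[c, b]" and r = "[]"])
      (simp_all add: braid121_def braid212_def)
  finally show ?thesis .
qed

lemma rotate_braids:
  assumes "tangle_equiv M [a, b, c] [c, b, a] (braid121 x y z a b c) (braid212 x' y' z' a b c)"
  shows "tangle_equiv M [b, c, opp a] [opp a, c, b]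
    (braid212 (turn y) (turn x) z b c (opp a)) (braid121 x' (turn z') (turn y') b c (opp a))"
proof -
  have "tangle_equiv M [b, c, opp a] [opp a, c, b]
     (([], Cup (opp a), [b, c, opp a]) # place [opp a] [opp a] (braid121 x y z a b c)
        @ [([opp a, c, b], Cap a, [])])
     (([], Cup (opp a), [b, c, opp a]) # place [opp a] [opp a] (braid212 x' y' z' a b c)
        @ [([opp a, c, b], Cap a, [])])"
    by (rule tangle_equiv_at[OF assms, where n = 1 and l = "[opp a]" and r = "[opp a]"])
      (simp_all add: braid121_def braid212_def)
  then show ?thesis
    using rotate_braid121 rotate_braid212 by (meson tangle_equiv_sym tangle_equiv_trans)
qed

text \<open>The crossing slides along two parallel arcs over their maxima; it is turned once at each
  maximum, so its type is restored.\<close>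

lemma crossing_over_nested_caps:
  "tangle_equiv M [a, b, opp a, opp b] []
     [([], Cross x a b, [opp a, opp b]), ([b], Cap a, [opp b]), ([], Cap b, [])]
     [([a, b], Cross x (opp a) (opp b), []), ([a], Cap b, [opp a]), ([], Cap a, [])]"
proof -
  let ?R = "tangle_equiv M [a, b, opp a, opp b] []"
  have "?R [([], Cross x a b, [opp a, opp b]),
      ([b], Cap a, [opp b]),
      ([], Cap b, [])]
     [([a], Cross (turn x) b (opp a), [opp b]),
      ([], Cap a, [b, opp b]),
      ([], Cap b, [])]"
    by (rule tangle_equiv_at[OF equiv_cap_through_crossing[of M a b x],
          where n = 0 and l = "[]" and r = "[opp b]"])
      simp_all
  also have "?R \<dots>
     [([a], Cross (turn x) b (opp a), [opp b]),
      ([a, opp a], Cap b, []),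
      ([], Cap a, [])]"
    by (rule tangle_equiv_at[OF equiv_exchange[of M "Cap a" "[]" "Cap b"],
          where n = 1 and l = "[]" and r = "[]"])
      simp_all
  also have "?R \<dots>
     [([a, b], Cross x (opp a) (opp b), []),
      ([a], Cap b, [opp a]),
      ([], Cap a, [])]"
    by (rule tangle_equiv_at[OF equiv_cap_through_crossing[of M b "opp a" "turn x"],
          where n = 0 and l = "[a]" and r = "[]"])
      simp_all
  finally show ?thesis .
qed

subsection \<open>Type 4\<close>

lemma equiv_Omega2:
  assumes "Omega2 \<subseteq> M"
  shows "tangle_equiv M [a, b] [a, b]
    [([], Cross (Classical w) a b, []), ([], Cross (Classical (\<not> w)) b a, [])] []"
  using assms by (intro tangle_equiv_move) (auto simp: Omega2_def)

text \<open>The crossing of \<open>a\<close> and \<open>b\<close> is lowest in one word and highest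
  in the other. Adding its inverse below and above therefore cancels it at opposite ends of the two
  sides.\<close>

lemma conjugate_braids_left:
  assumes "Omega2 \<subseteq> M"
    and "tangle_equiv M [a, b, c] [c, b, a]
      (braid121 (Classical (\<not> w)) y z a b c) (braid212 z' y' (Classical (\<not> w)) a b c)"
  shows "tangle_equiv M [b, a, c] [c, a, b]
    (braid212 y z (Classical w) b a c) (braid121 (Classical w) z' y' b a c)"
proof -
  let ?R = "tangle_equiv M [b, a, c] [c, a, b]"
  have "?R (braid212 y z (Classical w) b a c)
     (([], Cross (Classical w) b a, [c]) # braid121 (Classical (\<not> w)) y z a b c
        @ [([c], Cross (Classical w) b a, [])])"
    by (rule tangle_equiv_at[OF tangle_equiv_sym[OF equiv_Omega2[OF assms(1), of b a w]],
          where n = 0 and l = "[]" and r = "[c]"])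
      (simp_all add: braid121_def braid212_def)
  also have "?R \<dots>
     (([], Cross (Classical w) b a, [c]) # braid212 z' y' (Classical (\<not> w)) a b c
        @ [([c], Cross (Classical w) b a, [])])"
    by (rule tangle_equiv_at[OF assms(2),
          where n = 1 and l = "[]" and r = "[]"])
      (simp_all add: braid121_def braid212_def)
  also have "?R \<dots>
     (braid121 (Classical w) z' y' b a c)"
    by (rule tangle_equiv_at[OF equiv_Omega2[OF assms(1), of a b "\<not> w"],
          where n = 3 and l = "[c]" and r = "[]"])
      (simp_all add: braid121_def braid212_def)
  finally show ?thesis .
qed

text \<open>The same cancellation for the crossing of \<open>b\<close> and \<open>c\<close>, which
  is highest in the first word and lowest in the second.\<close>

lemma conjugate_braids_right:
  assumes "Omega2 \<subseteq> M"
    and "tangle_equiv M [a, b, c] [c, b, a]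
      (braid121 y z (Classical (\<not> w)) a b c) (braid212 (Classical (\<not> w)) z' y' a b c)"
  shows "tangle_equiv M [a, c, b] [b, c, a]
    (braid121 z' y' (Classical w) a c b) (braid212 (Classical w) y z a c b)"
proof -
  let ?R = "tangle_equiv M [a, c, b] [b, c, a]"
  have "?R (braid121 z' y' (Classical w) a c b)
     (([a], Cross (Classical w) c b, []) # braid212 (Classical (\<not> w)) z' y' a b c
        @ [([], Cross (Classical w) c b, [a])])"
    by (rule tangle_equiv_at[OF tangle_equiv_sym[OF equiv_Omega2[OF assms(1), of c b w]],
          where n = 0 and l = "[a]" and r = "[]"])
      (simp_all add: braid121_def braid212_def)
  also have "?R \<dots>
     (([a], Cross (Classical w) c b, []) # braid121 y z (Classical (\<not> w)) a b c
        @ [([], Cross (Classical w) c b, [a])])"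
    by (rule tangle_equiv_at[OF tangle_equiv_sym[OF assms(2)],
          where n = 1 and l = "[]" and r = "[]"])
      (simp_all add: braid121_def braid212_def)
  also have "?R \<dots>
     (braid212 (Classical w) y z a c b)"
    by (rule tangle_equiv_at[OF equiv_Omega2[OF assms(1), of b c "\<not> w"],
          where n = 3 and l = "[]" and r = "[a]"])
      (simp_all add: braid121_def braid212_def)
  finally show ?thesis .
qed

definition vertical_derivable where
  "vertical_derivable M w a b c \<longleftrightarrow>
     tangle_equiv M [a, c, b] [b, c, a]
       (fst (Omega4_vertical w a b c)) (snd (Omega4_vertical w a b c))"

definition horizontal_derivable where
  "horizontal_derivable M w a b c \<longleftrightarrow>
     tangle_equiv M [c, a, b] [b, a, c]
       (fst (Omega4_horizontal w a b c)) (snd (Omega4_horizontal w a b c))"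

lemma vertical_derivable_braids:
  "vertical_derivable M w a b c \<longleftrightarrow>
     tangle_equiv M [a, c, b] [b, c, a]
       (braid121 (Classical (\<not> w)) Singular (Classical w) a c b)
       (braid212 (Classical w) Singular (Classical (\<not> w)) a c b)"
  by (simp add: vertical_derivable_def Omega4_vertical_def braid121_def braid212_def)

lemma horizontal_derivable_braids:
  "horizontal_derivable M w a b c \<longleftrightarrow>
     tangle_equiv M [c, a, b] [b, a, c]
       (braid212 Singular (Classical w) (Classical w) c a b)
       (braid121 (Classical w) (Classical w) Singular c a b)"
  by (simp add: horizontal_derivable_def Omega4_horizontal_def braid121_def braid212_def)

text \<open>Conjugation by the crossing of \<open>a\<close> and \<open>c\<close> moves the start of
  the third strand from between the branches to their left.\<close>

lemma horizontal_if_vertical: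
  assumes "Omega2 \<subseteq> M" "vertical_derivable M w a b c"
  shows "horizontal_derivable M w a b c"
  using assms(2) conjugate_braids_left[OF assms(1)]
  unfolding vertical_derivable_braids horizontal_derivable_braids by blast

text \<open>
  A sixth of a turn takes the horizontal strand to the other diagonal of the disk; read in the
  same direction as before, its orientation is reversed.
\<close>

lemma vertical_opp_if_horizontal:
  assumes "Omega2 \<subseteq> M" "horizontal_derivable M w a b c"
  shows "vertical_derivable M w a b (opp c)"
proof -
  have "tangle_equiv M [a, b, opp c] [opp c, b, a]
      (braid121 Singular (Classical (\<not> w)) (Classical (\<not> w)) a b (opp c))
      (braid212 (Classical (\<not> w)) (Classical (\<not> w)) Singular a b (opp c))"
    using rotate_braids[OF tangle_equiv_sym[OF assms(2)[unfolded horizontal_derivable_braids]]]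
    by (simp add: tangle_equiv_sym)
  then show ?thesis
    unfolding vertical_derivable_braids by (rule conjugate_braids_right[OF assms(1)])
qed

text \<open>Here the strand bent around is the branch \<open>a\<close>, not the third strand: it
  reappears reversed on the right, and the singular crossing has been turned.\<close>

lemma horizontal_if_vertical_turned:
  assumes "vertical_derivable M w a b c"
  shows "horizontal_derivable M w b (opp a) c"
  using rotate_braids[OF assms[unfolded vertical_derivable_braids]]
  unfolding horizontal_derivable_braids by simp

lemma vertical_derivable_opp:
  assumes "Omega2 \<subseteq> M" "vertical_derivable M w a b c"
  shows "vertical_derivable M w a b (opp c)"
  using assms horizontal_if_vertical vertical_opp_if_horizontal by blast

lemma vertical_derivable_turn:
  assumes "Omega2 \<subseteq> M" "vertical_derivable M w a b c"
  shows "vertical_derivable M w b (opp a) c"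
  \<comment> \<open>The detour through the horizontal form reverses the third strand; a second
    reversal restores \<open>c\<close>.\<close>
  using vertical_opp_if_horizontal[OF assms(1) horizontal_if_vertical_turned[OF assms(2)]]
    vertical_derivable_opp[OF assms(1), of w b "opp a" "opp c"]
  by simp

text \<open>The map from \<open>(a, b)\<close> to \<open>(b, opp a)\<close> is a cycle through all
  four orientations of the branches, and \<open>c\<close> can be reversed separately. Since
  \<open>w\<close> stays fixed, the over and the under case each start from a move of their
  own.\<close>

lemma vertical_derivable_all:
  assumes "Omega2 \<subseteq> M" "vertical_derivable M w a0 b0 c0"
  shows "vertical_derivable M w a b c"
proof -
  have "vertical_derivable M w a0 b0 c"
    using assms(2) vertical_derivable_opp[OF assms] by (cases c; cases c0) auto
  moreover have "vertical_derivable M w b (opp a) c" "vertical_derivable M w (opp a) (opp b) c"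
    "vertical_derivable M w (opp b) a c" if "vertical_derivable M w a b c" for a b
    using vertical_derivable_turn[OF assms(1)] that by (metis opp_opp)+
  ultimately show ?thesis
    by (cases a; cases b; cases a0; cases b0) (metis opp.simps)+
qed

subsection \<open>Type 5\<close>

text \<open>A zigzag on the right leg supplies a minimum which, passed through the crossing, makes
  the two strands there parallel; the result is a left-hand kink of \<open>Omega1\<close> with the
  crossing turned.\<close>

lemma equiv_kinked_cap:
  assumes "Omega1 \<subseteq> M"
  shows "tangle_equiv M [a, opp a] []
    [([], Cross (Classical w) a (opp a), []), ([], Cap (opp a), [])] [([], Cap a, [])]"
proof -
  let ?R = "tangle_equiv M [a, opp a] []"
  have kink: "tangle_equiv M [a] [a]
    [([], Cup (opp a), [a]), ([opp a], Cross (Classical (\<not> w)) a a, []), ([], Cap (opp a), [a])] []"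
    using assms by (intro tangle_equiv_move) (auto simp: Omega1_def)
  have "?R [([], Cross (Classical w) a (opp a), []),
      ([], Cap (opp a), [])]
     [([a], Cup (opp a), [opp a]),
      ([a, opp a], Cap a, []),
      ([], Cross (Classical w) a (opp a), []),
      ([], Cap (opp a), [])]"
    by (rule tangle_equiv_at[OF tangle_equiv_sym[OF equiv_zigzag_right[of M "opp a"]],
          where n = 0 and l = "[a]" and r = "[]"])
      simp_all
  also have "?R \<dots>
     [([a], Cup (opp a), [opp a]),
      ([], Cross (Classical w) a (opp a), [a, opp a]),
      ([], Cap (opp a), [a, opp a]),
      ([], Cap a, [])]"
    by (rule tangle_equiv_at[OF tangle_equiv_sym[OF
            equiv_exchange_tangle[of "[a, opp a]" "[([], Cross (Classical w) a (opp a), []),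
      ([], Cap (opp a), [])]" "[]" M "Cap a"]],
          where n = 1 and l = "[]" and r = "[]"])
      simp_all
  also have "?R \<dots>
     [([], Cup (opp a), [a, opp a]),
      ([opp a], Cross (Classical (\<not> w)) a a, [opp a]),
      ([], Cap (opp a), [a, opp a]),
      ([], Cap a, [])]"
    by (rule tangle_equiv_at[OF equiv_cup_through_crossing[of M a "opp a" "Classical w"],
          where n = 0 and l = "[]" and r = "[opp a]"])
      simp_all
  also have "?R \<dots>
     [([], Cap a, [])]"
    by (rule tangle_equiv_at[OF kink,
          where n = 0 and l = "[]" and r = "[opp a]"])
      simp_all
  finally show ?thesis .
qed

definition Omega5_derivable where
  "Omega5_derivable M w a b \<longleftrightarrow>
     tangle_equiv M [a, b] [a, b] (fst (Omega5_move w a b)) (snd (Omega5_move w a b))"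

text \<open>Conjugating by the inverse of the classical crossing moves that inverse past the
  singular crossing. This interchanges the strands and changes the sign of the classical
  crossing.\<close>

lemma Omega5_derivable_swap:
  assumes "Omega2 \<subseteq> M" "Omega5_derivable M w a b"
  shows "Omega5_derivable M (\<not> w) b a"
proof -
  let ?R = "tangle_equiv M [b, a] [b, a]"
  note move = assms(2)[unfolded Omega5_derivable_def Omega5_move_def fst_conv snd_conv]
  have "?R [([], Cross Singular b a, []),
      ([], Cross (Classical (\<not> w)) a b, [])]
     [([], Cross (Classical (\<not> w)) b a, []),
      ([], Cross (Classical w) a b, []),
      ([], Cross Singular b a, []),
      ([], Cross (Classical (\<not> w)) a b, [])]"
    by (rule tangle_equiv_at[OF tangle_equiv_sym[OF equiv_Omega2[OF assms(1), of b a "\<not> w"]],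
          where n = 0 and l = "[]" and r = "[]"])
      simp_all
  also have "?R \<dots>
     [([], Cross (Classical (\<not> w)) b a, []),
      ([], Cross Singular a b, []),
      ([], Cross (Classical w) b a, []),
      ([], Cross (Classical (\<not> w)) a b, [])]"
    by (rule tangle_equiv_at[OF tangle_equiv_sym[OF move],
          where n = 1 and l = "[]" and r = "[]"])
      simp_all
  also have "?R \<dots>
     [([], Cross (Classical (\<not> w)) b a, []),
      ([], Cross Singular a b, [])]"
    by (rule tangle_equiv_at[OF equiv_Omega2[OF assms(1), of b a w],
          where n = 2 and l = "[]" and r = "[]"])
      simp_all
  finally show ?thesis
    unfolding Omega5_derivable_def Omega5_move_def by simp
qed

text \<open>
  Passing a leg over or under the other three legs of a singular crossing turns the crossing by a
  quarter turn; here all legs run to the bottom, and one of the three crossings is moved to the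
  left-hand side.
\<close>

lemma leg_across_crossing:
  assumes "Omega1 \<subseteq> M" "horizontal_derivable M (\<not> w) (opp b) (opp a) b"
  shows "tangle_equiv M [a, b, opp b, opp a] []
    [([], Cross (Classical w) a b, [opp b, opp a]),
      ([b, a], Cross Singular (opp b) (opp a), []),
      ([b], Cap a, [opp b]),
      ([], Cap b, [])]
    [([a], Cross (Classical (\<not> w)) b (opp b), [opp a]),
      ([a, opp b], Cross (Classical (\<not> w)) b (opp a), []),
      ([], Cross Singular a (opp b), [opp a, b]),
      ([opp b], Cap a, [b]),
      ([], Cap (opp b), [])]"
proof -
  let ?R = "tangle_equiv M [a, b, opp b, opp a] []"
  note move = assms(2)[unfolded horizontal_derivable_def Omega4_horizontal_def fst_conv snd_conv]
  have "?R [([], Cross (Classical w) a b, [opp b, opp a]),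
      ([b, a], Cross Singular (opp b) (opp a), []),
      ([b], Cap a, [opp b]),
      ([], Cap b, [])]
     [([a, b], Cross Singular (opp b) (opp a), []),
      ([], Cross (Classical w) a b, [opp a, opp b]),
      ([b], Cap a, [opp b]),
      ([], Cap b, [])]"
    by (rule tangle_equiv_at[OF equiv_exchange[of M "Cross (Classical w) a b" "[]" "Cross Singular (opp b) (opp a)"],
          where n = 0 and l = "[]" and r = "[]"])
      simp_all
  also have "?R \<dots>
     [([a, b], Cross Singular (opp b) (opp a), []),
      ([a], Cross (Classical (\<not> w)) b (opp a), [opp b]),
      ([], Cap a, [b, opp b]),
      ([], Cap b, [])]"
    by (rule tangle_equiv_at[OF equiv_cap_through_crossing[of M a b "Classical w"],
          where n = 1 and l = "[]" and r = "[opp b]"])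
      simp_all
  \<comment> \<open>The strand \<open>b\<close> crosses only one upper leg of the singular crossing;
    the kink adds its crossing with the other one, as the horizontal move requires.\<close>
  also have "?R \<dots>
     [([a, b], Cross Singular (opp b) (opp a), []),
      ([a], Cross (Classical (\<not> w)) b (opp a), [opp b]),
      ([], Cap a, [b, opp b]),
      ([], Cross (Classical (\<not> w)) b (opp b), []),
      ([], Cap (opp b), [])]"
    by (rule tangle_equiv_at[OF tangle_equiv_sym[OF equiv_kinked_cap[OF assms(1), of b "\<not> w"]],
          where n = 3 and l = "[]" and r = "[]"])
      simp_all
  also have "?R \<dots>
     [([a, b], Cross Singular (opp b) (opp a), []),
      ([a], Cross (Classical (\<not> w)) b (opp a), [opp b]),
      ([a, opp a], Cross (Classical (\<not> w)) b (opp b), []),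
      ([], Cap a, [opp b, b]),
      ([], Cap (opp b), [])]"
    by (rule tangle_equiv_at[OF equiv_exchange[of M "Cap a" "[]" "Cross (Classical (\<not> w)) b (opp b)"],
          where n = 2 and l = "[]" and r = "[]"])
      simp_all
  also have "?R \<dots>
     [([a], Cross (Classical (\<not> w)) b (opp b), [opp a]),
      ([a, opp b], Cross (Classical (\<not> w)) b (opp a), []),
      ([a], Cross Singular (opp b) (opp a), [b]),
      ([], Cap a, [opp b, b]),
      ([], Cap (opp b), [])]"
    by (rule tangle_equiv_at[OF move,
          where n = 0 and l = "[a]" and r = "[]"])
      simp_all
  \<comment> \<open>Passing the maximum of \<open>a\<close> through the singular crossing is the
    quarter turn.\<close>
  also have "?R \<dots>
     [([a], Cross (Classical (\<not> w)) b (opp b), [opp a]),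
      ([a, opp b], Cross (Classical (\<not> w)) b (opp a), []),
      ([], Cross Singular a (opp b), [opp a, b]),
      ([opp b], Cap a, [b]),
      ([], Cap (opp b), [])]"
    by (rule tangle_equiv_at[OF tangle_equiv_sym[OF
            equiv_cap_through_crossing[of M a "opp b" Singular]],
          where n = 2 and l = "[]" and r = "[b]"])
      simp_all
  finally show ?thesis .
qed

text \<open>
  Number the legs of a singular crossing 1 to 4, all running to the bottom, and let \<open>s\<^sub>i\<close> cross the
  legs in positions \<open>i\<close> and \<open>i + 1\<close>.  Up to bending, a type 5 move on the crossing \<open>v\<close> reads
  \<open>s\<^sub>1 v = s\<^sub>3 v\<close>.  If \<open>u\<close> is the crossing turned by a quarter turn, then
  \<open>s\<^sub>1 v = s\<^sub>2\<^sup>-\<^sup>1 s\<^sub>3\<^sup>-\<^sup>1 u = s\<^sub>2\<^sup>-\<^sup>1 s\<^sub>1\<^sup>-\<^sup>1 u = s\<^sub>2\<^sup>-\<^sup>1 s\<^sub>2 s\<^sub>3 v = s\<^sub>3 v\<close>, where the middle equation is the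
  type 5 move on \<open>u\<close> and the two next to it pass a leg under or over the crossing.
\<close>

lemma Omega5_derivable_turn:
  assumes "Omega1 \<union> Omega2 \<subseteq> M"
    and horizontal: "\<And>w a b c. horizontal_derivable M w a b c"
    and "Omega5_derivable M (\<not> w) a (opp b)"
  shows "Omega5_derivable M w a b"
proof -
  have moves: "Omega1 \<subseteq> M" "Omega2 \<subseteq> M"
    using assms(1) by auto
  note move = assms(3)[unfolded Omega5_derivable_def Omega5_move_def fst_conv snd_conv]
  let ?R = "tangle_equiv M [a, b, opp b, opp a] []"
  let ?X = "fst (Omega5_move w a b)" and ?Y = "snd (Omega5_move w a b)"
  let ?c = "[([a], Cap b, [opp a]), ([], Cap a, [])]"
  have "?R (place [] [opp b, opp a] ?Y @ ?c)
     [([], Cross (Classical w) a b, [opp b, opp a]),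
      ([b, a], Cross Singular (opp b) (opp a), []),
      ([b], Cap a, [opp b]),
      ([], Cap b, [])]"
    by (rule tangle_equiv_at[OF crossing_over_nested_caps[of M b a Singular],
          where n = 1 and l = "[]" and r = "[]"])
      (simp_all add: Omega5_move_def)
  also have "?R \<dots>
     [([a], Cross (Classical (\<not> w)) b (opp b), [opp a]),
      ([a, opp b], Cross (Classical (\<not> w)) b (opp a), []),
      ([], Cross Singular a (opp b), [opp a, b]),
      ([opp b], Cap a, [b]),
      ([], Cap (opp b), [])]"
    by (rule tangle_equiv_at[OF leg_across_crossing[OF moves(1) horizontal, of a b w],
          where n = 0 and l = "[]" and r = "[]"])
      (simp_all add: Omega5_move_def)
  also have "?R \<dots>
     [([a], Cross (Classical (\<not> w)) b (opp b), [opp a]),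
      ([], Cross Singular a (opp b), [b, opp a]),
      ([opp b, a], Cross (Classical (\<not> w)) b (opp a), []),
      ([opp b], Cap a, [b]),
      ([], Cap (opp b), [])]"
    by (rule tangle_equiv_at[OF tangle_equiv_sym[OF
            equiv_exchange[of M "Cross Singular a (opp b)" "[]" "Cross (Classical (\<not> w)) b (opp a)"]],
          where n = 1 and l = "[]" and r = "[]"])
      (simp_all add: Omega5_move_def)
  also have "?R \<dots>
     [([a], Cross (Classical (\<not> w)) b (opp b), [opp a]),
      ([], Cross Singular a (opp b), [b, opp a]),
      ([], Cross (Classical (\<not> w)) (opp b) a, [b, opp a]),
      ([a], Cap (opp b), [opp a]),
      ([], Cap a, [])]"
    by (rule tangle_equiv_at[OF tangle_equiv_sym[OF
            crossing_over_nested_caps[of M "opp b" a "Classical (\<not> w)"]],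
          where n = 2 and l = "[]" and r = "[]"])
      (simp_all add: Omega5_move_def)
  also have "?R \<dots>
     [([a], Cross (Classical (\<not> w)) b (opp b), [opp a]),
      ([], Cross (Classical (\<not> w)) a (opp b), [b, opp a]),
      ([], Cross Singular (opp b) a, [b, opp a]),
      ([a], Cap (opp b), [opp a]),
      ([], Cap a, [])]"
    by (rule tangle_equiv_at[OF move,
          where n = 1 and l = "[]" and r = "[b, opp a]"])
      (simp_all add: Omega5_move_def)
  also have "?R \<dots>
     [([a], Cross (Classical (\<not> w)) b (opp b), [opp a]),
      ([], Cross (Classical (\<not> w)) a (opp b), [b, opp a]),
      ([opp b, a], Cross Singular b (opp a), []),
      ([opp b], Cap a, [b]),
      ([], Cap (opp b), [])]"
    by (rule tangle_equiv_at[OF crossing_over_nested_caps[of M "opp b" a Singular],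
          where n = 2 and l = "[]" and r = "[]"])
      (simp_all add: Omega5_move_def)
  also have "?R \<dots>
     [([a], Cross (Classical (\<not> w)) b (opp b), [opp a]),
      ([a], Cross (Classical w) (opp b) b, [opp a]),
      ([a, b], Cross (Classical w) (opp b) (opp a), []),
      ([], Cross Singular a b, [opp a, opp b]),
      ([b], Cap a, [opp b]),
      ([], Cap b, [])]"
    by (rule tangle_equiv_at[OF leg_across_crossing[OF moves(1) horizontal, of a "opp b" "\<not> w"],
          where n = 1 and l = "[]" and r = "[]"])
      (simp_all add: Omega5_move_def)
  also have "?R \<dots>
     [([a, b], Cross (Classical w) (opp b) (opp a), []),
      ([], Cross Singular a b, [opp a, opp b]),
      ([b], Cap a, [opp b]),
      ([], Cap b, [])]"
    by (rule tangle_equiv_at[OF equiv_Omega2[OF moves(2), of b "opp b" "\<not> w"],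
          where n = 0 and l = "[a]" and r = "[opp a]"])
      (simp_all add: Omega5_move_def)
  also have "?R \<dots>
     [([], Cross Singular a b, [opp b, opp a]),
      ([b, a], Cross (Classical w) (opp b) (opp a), []),
      ([b], Cap a, [opp b]),
      ([], Cap b, [])]"
    by (rule tangle_equiv_at[OF tangle_equiv_sym[OF
            equiv_exchange[of M "Cross Singular a b" "[]" "Cross (Classical w) (opp b) (opp a)"]],
          where n = 0 and l = "[]" and r = "[]"])
      (simp_all add: Omega5_move_def)
  also have "?R \<dots>
     (place [] [opp b, opp a] ?X @ ?c)"
    by (rule tangle_equiv_at[OF tangle_equiv_sym[OF
            crossing_over_nested_caps[of M b a "Classical w"]],
          where n = 1 and l = "[]" and r = "[]"])
      (simp_all add: Omega5_move_def)
  finally have "?R (place [] [opp b, opp a] ?Y @ ?c) (place [] [opp b, opp a] ?X @ ?c)" .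
  then have "tangle_equiv M [a, b, opp b] [a]
      (place [] [opp b] ?Y @ [([a], Cap b, [])]) (place [] [opp b] ?X @ [([a], Cap b, [])])"
    using unbend_right[of "[a, b, opp b]" "place [] [opp b] ?Y @ [([a], Cap b, [])]" "[]" a
        "place [] [opp b] ?X @ [([a], Cap b, [])]" M]
    by (simp add: Omega5_move_def)
  then have "tangle_equiv M [a, b] [a, b] ?Y ?X"
    using unbend_right[of "[a, b]" ?Y "[a]" b ?X M] by (simp add: Omega5_move_def)
  then show ?thesis
    unfolding Omega5_derivable_def by (rule tangle_equiv_sym)
qed

lemma Omega5_derivable_all:
  assumes "Omega1 \<union> Omega2 \<subseteq> M"
    and "\<And>w a b c. horizontal_derivable M w a b c"
    and "Omega5_derivable M w0 Down Down"
  shows "Omega5_derivable M w a b"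
proof -
  have swap: "Omega5_derivable M w a b" if "Omega5_derivable M (\<not> w) b a" for w a b
    using Omega5_derivable_swap[OF _ that] assms(1) by simp
  note turn = Omega5_derivable_turn[OF assms(1,2)]
  have DD: "Omega5_derivable M w Down Down" for w
    using swap[of "\<not> w0" Down Down] assms(3) by (cases "w = w0") auto
  have DU: "Omega5_derivable M w Down Up" for w
    by (rule turn) (simp add: DD)
  have UD: "Omega5_derivable M w Up Down" for w
    by (rule swap) (rule DU)
  have UU: "Omega5_derivable M w Up Up" for w
    by (rule turn) (simp add: UD)
  show ?thesis
    using DD DU UD UU by (cases a; cases b) auto
qed

theorem theorem5p1:
  fixes D D' :: diagram
  assumes "oriented_move (Omega4 \<union> Omega5) D D'"
  shows "realizable (Omega4a \<union> Omega4e \<union> Omega5a \<union> Omega1 \<union> Omega2 \<union> Omega3) D D'"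
proof -
  let ?M = "Omega4a \<union> Omega4e \<union> Omega5a \<union> Omega1 \<union> Omega2 \<union> Omega3"
  have "vertical_derivable ?M w Down Down Up" for w
    unfolding vertical_derivable_def
    by (rule tangle_equiv_move, cases w)
      (auto simp: Omega4a_def Omega4e_def Omega4_vertical_def)
  then have vertical: "vertical_derivable ?M w a b c" for w a b c
    by (rule vertical_derivable_all[rotated]) blast
  then have horizontal: "horizontal_derivable ?M w a b c" for w a b c
    by (rule horizontal_if_vertical[rotated]) blast
  have "Omega5_derivable ?M True Down Down"
    unfolding Omega5_derivable_def
    by (rule tangle_equiv_move) (auto simp: Omega5a_def positive_def Omega5_move_def)
  then have Omega5: "Omega5_derivable ?M w a b" for w a b
    by (rule Omega5_derivable_all[OF _ horizontal, rotated]) blast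
  have move: "\<exists>u v. tangle_equiv ?M u v T T' \<and> tangle u T v \<and> T \<noteq> []"
    if "(T, T') \<in> Omega4 \<union> Omega5" for T T'
  proof -
    from that consider w a b c where "(T, T') = Omega4_vertical w a b c"
      | w a b c where "(T, T') = Omega4_horizontal w a b c"
      | w a b where "(T, T') = Omega5_move w a b"
      unfolding Omega4_def Omega5_def by blast
    then show ?thesis
    proof cases
      case (1 w a b c)
      then show ?thesis
        using vertical[of w a b c] unfolding vertical_derivable_def
        by (intro exI[of _ "[a, c, b]"] exI[of _ "[b, c, a]"]) (simp add: Omega4_vertical_def)
    next
      case (2 w a b c)
      then show ?thesis
        using horizontal[of w a b c] unfolding horizontal_derivable_def
        by (intro exI[of _ "[c, a, b]"] exI[of _ "[b, a, c]"]) (simp add: Omega4_horizontal_def)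
    next
      case (3 w a b)
      then show ?thesis
        using Omega5[of w a b] unfolding Omega5_derivable_def
        by (intro exI[of _ "[a, b]"]) (simp add: Omega5_move_def)
    qed
  qed
  from assms obtain E E' where E: "planar_isotopic D E" "local_replacement (Omega4 \<union> Omega5) E E'"
    "planar_isotopic E' D'"
    unfolding oriented_move_def by blast
  from E(2) obtain T T' A B l r where T: "(T, T') \<in> Omega4 \<union> Omega5"
    and EE': "E = A @ place l r T @ B" "E' = A @ place l r T' @ B" and "tangle [] E []"
    unfolding local_replacement_def singular_link_diagram_def by blast
  from move[OF T] obtain u v where eq: "tangle_equiv ?M u v T T'"
    and uv: "tangle u T v" "T \<noteq> []"
    by blast
  from \<open>tangle [] E []\<close> obtain u' v' where A: "tangle [] A u'" and B: "tangle v' B []"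
    and "tangle u' (place l r T) v'"
    unfolding EE' tangle_append by blast
  then have "u' = l @ u @ r \<and> v' = l @ v @ r"
    using tangle_boundary_unique tangle_place[OF uv(1)] uv(2) by (metis length_0_conv length_place)
  then have "tangle_equiv ?M [] [] E E'"
    unfolding EE' using A B by (intro tangle_equiv_context[OF eq]) auto
  then have "realizable ?M E E'"
    by (rule realizable_if_tangle_equiv)
  moreover have "realizable ?M D E" "realizable ?M E' D'"
    using E(1,3) unfolding realizable_def by blast+
  ultimately show ?thesis
    unfolding realizable_def by (meson rtranclp_trans)
qed

end
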